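(* Let $(X_i^n)_{n\ge 1,\ 1\le i\le n}$ be a triangular array of real random variables, all independent, such that for each $n\ge1$ the variables $X_1^n,\dots,X_n^n$ have the same law $\mu_n$, with mean zero, variance $1$, and such that $\sum_{n\ge1} n^{-2}\int_{\mathbb{R}}|x|^3\mu_n(dx)<\infty$. Assume further that each $\mu_n$ is infinitely divisible, with characteristic function $\phi_n(u)=\exp(\psi_n(u))$, where $$\psi_n(u)=-\frac{\sigma_nu^2}{2}+\int_{-\infty}^{\infty}\left(e^{iux}-1-iux\right)\nu_n(dx),$$ with $\sigma_n\ge 0$ and $\nu_n$ the Lévy measure of $\mu_n$ (a nonnegative measure on $\mathbb{R}$ with $\nu_n(\{0\})=0$), satisfying $$\int_{-\infty}^{\infty}x^2\nu_n(dx)=1-\sigma_n\in[0,1],\qquad \int_{-\infty}^{\infty}|x|^3\nu_n(dx)<\infty,\qquad \sum_{n=1}^{\infty}\frac1{n^2}\int_{-\infty}^{\infty}|x|^3\nu_n(dx)<\infty.$$ For $N\ge1$ let $Z_N=\sum_{n=1}^{N}\frac{1}{n}(X_1^n+\cdots+X_n^n)$ and $H_N=\sum_{n=1}^N\frac1n$. Then the sequence $(Z_N)$ strongly converges in the mod-Gaussian sense with parameters $(0,H_N)$ and limiting function $\Phi=e^{\Psi}$, where $$\Psi(u)=\int_{-\infty}^{\infty}\left(e^{iux}-1-iux+\frac{u^2x^2}{2}\right)\nu(dx),\qquad \nu=\sum_{n=1}^{\infty}n\,\nu_n',$$ and $\nu_n'$ is the measure defined by $\nu_n'(A)=\int_{-\infty}^{\infty}\mathbf{1}_A(x/n)\,\nu_n(dx)$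 for every Borel set $A\subset\mathbb{R}$. Moreover $\nu$ is a positive measure satisfying $\nu(\{0\})=0$ and $\int_{-\infty}^{\infty}|x|^3\nu(dx)<\infty$.
   Context: A sequence $(Z_N)$ of real random variables strongly converges in the mod-Gaussian sense with parameters $(\beta_N,\gamma_N)$ (where $\beta_N\in\mathbb{R}$, $\gamma_N\ge0$) and limiting function $\Phi:\mathbb{R}\to\mathbb{C}$ (continuous at $0$) if $e^{-iu\beta_N+u^2\gamma_N/2}\,\mathbb{E}[e^{iuZ_N}]\to\Phi(u)$ as $N\to\infty$, uniformly in $u$ on every compact subset of $\mathbb{R}$. *)

theory Defs
  imports "HOL-Probability.Probability"
begin

primrec convolution_power :: "real measure \<Rightarrow> nat \<Rightarrow> real measure" where
  "convolution_power \<rho> 0 = return borel 0"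
| "convolution_power \<rho> (Suc k) = convolution \<rho> (convolution_power \<rho> k)"

definition infinitely_divisible :: "real measure \<Rightarrow> bool" where
  "infinitely_divisible \<mu> \<longleftrightarrow>
     real_distribution \<mu> \<and>
     (\<forall>k\<ge>1. \<exists>\<rho>. real_distribution \<rho> \<and> convolution_power \<rho> k = \<mu>)"

definition levy_measure :: "real measure \<Rightarrow> bool" where
  "levy_measure \<nu> \<longleftrightarrow>
     sets \<nu> = sets borel \<and> emeasure \<nu> {0} = 0 \<and>
     (\<integral>\<^sup>+x. ennreal (min 1 (x\<^sup>2)) \<partial>\<nu>) < \<infinity>"

text \<open>The parameter \<open>\<sigma>\<close> is the Gaussian variance itself, not its square root.  There is no
  truncation in the compensator \<open>\<i>ux\<close>: the formula is meant for Levy measures with a finite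
  second moment, for which the integrand is integrable.\<close>

definition levy_exponent :: "real \<Rightarrow> real measure \<Rightarrow> real \<Rightarrow> complex" where
  "levy_exponent \<sigma> \<nu> u =
     - complex_of_real (\<sigma> * u\<^sup>2 / 2) + (CLINT x|\<nu>. iexp (u * x) - 1 - \<i> * complex_of_real (u * x))"

definition strongly_mod_gaussian_convergent ::
  "'w measure \<Rightarrow> (nat \<Rightarrow> 'w \<Rightarrow> real) \<Rightarrow> (nat \<Rightarrow> real) \<Rightarrow> (nat \<Rightarrow> real) \<Rightarrow> (real \<Rightarrow> complex) \<Rightarrow> bool" where
  "strongly_mod_gaussian_convergent M Z \<beta> \<gamma> \<Phi> \<longleftrightarrow>
     (\<forall>N. Z N \<in> borel_measurable M) \<and> (\<forall>N. \<gamma> N \<ge> 0) \<and> isCont \<Phi> 0 \<and>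
     (\<forall>K. compact K \<longrightarrow>
        uniform_limit K
          (\<lambda>N u. exp (- \<i> * complex_of_real (u * \<beta> N) + complex_of_real (u\<^sup>2 * \<gamma> N / 2))
                 * (CLINT \<omega>|M. iexp (u * Z N \<omega>)))
          \<Phi> sequentially)"

definition rescaled_measure :: "(nat \<Rightarrow> real measure) \<Rightarrow> nat \<Rightarrow> real measure" where
  "rescaled_measure \<nu> n = distr (\<nu> n) borel (\<lambda>x. x / real n)"

text \<open>The set function \<open>A \<mapsto> \<Sum>n\<ge>1. n * \<nu>'\<^sub>n(A)\<close>; the index is shifted so that the sum starts at 1.\<close>

definition limit_set_function :: "(nat \<Rightarrow> real measure) \<Rightarrow> real set \<Rightarrow> ennreal" where
  "limit_set_function \<nu> A =
     (\<Sum>k. of_nat (Suc k) * emeasure (rescaled_measure \<nu> (Suc k)) A)"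

text \<open>\<open>measure_of\<close> yields the zero measure when its argument is not a measure, so this is the
  intended object only together with
  \<open>measure_space UNIV (sets borel) (limit_set_function \<nu>)\<close>.\<close>

definition limit_measure :: "(nat \<Rightarrow> real measure) \<Rightarrow> real measure" where
  "limit_measure \<nu> = measure_of UNIV (sets borel) (limit_set_function \<nu>)"

definition limit_exponent :: "real measure \<Rightarrow> real \<Rightarrow> complex" where
  "limit_exponent \<nu> u =
     (CLINT x|\<nu>. iexp (u * x) - 1 - \<i> * complex_of_real (u * x) + complex_of_real (u\<^sup>2 * x\<^sup>2 / 2))"

end

theory Submission
  imports Defs
begin

text \<open>By independence, \<open>exp (u\<^sup>2 H\<^sub>N / 2)\<close> times the characteristic function of \<open>Z\<^sub>N\<close> is the
  exponential of \<open>\<Sum>n\<le>N. n (\<psi>\<^sub>n (u / n) + u\<^sup>2 / (2 n\<^sup>2))\<close>.  Because \<open>1 = \<sigma>\<^sub>n + \<integral> x\<^sup>2 d\<nu>\<^sub>n\<close>, the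
  quadratic term cancels the Gaussian part and completes the integrand to the third-order Taylor
  remainder of \<open>exp (i u x / n)\<close>.  The \<open>n\<close>-th term is therefore at most
  \<open>\<bar>u\<bar>\<^sup>3 / (6 n\<^sup>2) \<integral> \<bar>x\<bar>\<^sup>3 d\<nu>\<^sub>n\<close>, the series converges locally uniformly by the Weierstrass
  M-test, and its sum is the integral of the remainder against \<open>\<Sum>n. n \<nu>'\<^sub>n\<close>.\<close>

section \<open>The limit measure and termwise integration against it\<close>

lemma measure_space_limit_set_function:
  "measure_space UNIV (sets borel) (limit_set_function \<nu>)"
proof -
  have "countably_additive (sets borel) (limit_set_function \<nu>)"
  proof (rule countably_additiveI)
    fix A :: "nat \<Rightarrow> real set"
    assume A: "range A \<subseteq> sets borel" "disjoint_family A" "(\<Union>i. A i) \<in> sets borel"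
    \<comment> \<open>integrating over the counting measure turns the interchange of the two sums into monotone convergence\<close>
    let ?m = "\<lambda>k. rescaled_measure \<nu> (Suc k)"
    have "(\<Sum>i. limit_set_function \<nu> (A i)) =
        (\<Sum>i. \<integral>\<^sup>+k. of_nat (Suc k) * emeasure (?m k) (A i) \<partial>count_space UNIV)"
      unfolding limit_set_function_def by (simp only: nn_integral_count_space_nat)
    also have "\<dots> = (\<integral>\<^sup>+k. (\<Sum>i. of_nat (Suc k) * emeasure (?m k) (A i)) \<partial>count_space UNIV)"
      by (rule nn_integral_suminf[symmetric]) simp
    also have "\<dots> = (\<Sum>k. \<Sum>i. of_nat (Suc k) * emeasure (?m k) (A i))"
      by (simp only: nn_integral_count_space_nat)
    also have "\<dots> = (\<Sum>k. of_nat (Suc k) * (\<Sum>i. emeasure (?m k) (A i)))"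
      by (simp only: ennreal_suminf_cmult)
    also have "\<dots> = limit_set_function \<nu> (\<Union>i. A i)"
      unfolding limit_set_function_def
      by (subst suminf_emeasure) (use A in \<open>auto simp: rescaled_measure_def\<close>)
    finally show "(\<Sum>i. limit_set_function \<nu> (A i)) = limit_set_function \<nu> (\<Union>i. A i)" .
  qed
  moreover have "positive (sets borel) (limit_set_function \<nu>)"
    by (simp add: positive_def limit_set_function_def)
  ultimately show ?thesis
    using sets.sigma_algebra_axioms[of "borel :: real measure"] by (simp add: measure_space_def)
qed

lemma sets_limit_measure [simp, measurable_cong]: "sets (limit_measure \<nu>) = sets borel"
  unfolding limit_measure_def by (metis sets.sets_measure_of_eq space_borel)

lemma emeasure_limit_measure:
  assumes "A \<in> sets borel"
  shows "emeasure (limit_measure \<nu>) A = limit_set_function \<nu> A"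
  using measure_space_limit_set_function[of \<nu>] assms unfolding limit_measure_def
  by (intro emeasure_measure_of_sigma) (auto simp: measure_space_def)

text \<open>For indicators this is the defining series. Both sides are additive, homogeneous and
  continuous along increasing sequences, so induction over nonnegative Borel functions carries it to
  every \<open>f\<close>.\<close>

lemma nn_integral_limit_measure:
  assumes "f \<in> borel_measurable borel"
  shows "(\<integral>\<^sup>+x. f x \<partial>limit_measure \<nu>) =
    (\<Sum>k. of_nat (Suc k) * (\<integral>\<^sup>+x. f x \<partial>rescaled_measure \<nu> (Suc k)))"
  using assms
proof induction
  case (cong f g)
  then show ?case
    by simp
next
  case (set A)
  then show ?case
    by (simp add: emeasure_limit_measure limit_set_function_def rescaled_measure_def del: of_nat_Suc)
next
  case (mult f c)
  have "(\<integral>\<^sup>+x. c * f x \<partial>limit_measure \<nu>) = c * (\<integral>\<^sup>+x. f x \<partial>limit_measure \<nu>)"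
    using mult by (intro nn_integral_cmult) simp
  also have "\<dots> = (\<Sum>k. c * (of_nat (Suc k) * (\<integral>\<^sup>+x. f x \<partial>rescaled_measure \<nu> (Suc k))))"
    by (simp only: mult ennreal_suminf_cmult)
  also have "\<dots> = (\<Sum>k. of_nat (Suc k) * (\<integral>\<^sup>+x. c * f x \<partial>rescaled_measure \<nu> (Suc k)))"
    using mult by (subst nn_integral_cmult) (auto simp: rescaled_measure_def mult.left_commute)
  finally show ?case .
next
  case (add f g)
  have "(\<integral>\<^sup>+x. g x + f x \<partial>limit_measure \<nu>) =
      (\<integral>\<^sup>+x. g x \<partial>limit_measure \<nu>) + (\<integral>\<^sup>+x. f x \<partial>limit_measure \<nu>)"
    using add by (intro nn_integral_add) simp_all
  also have "\<dots> = (\<Sum>k. of_nat (Suc k) * (\<integral>\<^sup>+x. g x \<partial>rescaled_measure \<nu> (Suc k)) +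
      of_nat (Suc k) * (\<integral>\<^sup>+x. f x \<partial>rescaled_measure \<nu> (Suc k)))"
    by (simp only: add suminf_add summableI)
  also have "\<dots> = (\<Sum>k. of_nat (Suc k) * (\<integral>\<^sup>+x. g x + f x \<partial>rescaled_measure \<nu> (Suc k)))"
    using add by (subst nn_integral_add) (auto simp: rescaled_measure_def distrib_left)
  finally show ?case .
next
  case (seq U)
  \<comment> \<open>Monotonicity in \<open>i\<close> is what allows the supremum to be moved inside
    the series over \<open>k\<close>.\<close>
  have mono: "incseq (\<lambda>i. \<integral>\<^sup>+x. U i x \<partial>rescaled_measure \<nu> k)" for k
    using seq by (auto simp: incseq_def le_fun_def intro!: nn_integral_mono)
  have "(\<integral>\<^sup>+x. (SUP i. U i) x \<partial>limit_measure \<nu>) = (SUP i. \<integral>\<^sup>+x. U i x \<partial>limit_measure \<nu>)"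
    using seq unfolding SUP_apply by (intro nn_integral_monotone_convergence_SUP) simp_all
  also have "\<dots> = (SUP i. \<Sum>k. of_nat (Suc k) * (\<integral>\<^sup>+x. U i x \<partial>rescaled_measure \<nu> (Suc k)))"
    by (simp only: seq)
  also have "\<dots> = (\<Sum>k. SUP i. of_nat (Suc k) * (\<integral>\<^sup>+x. U i x \<partial>rescaled_measure \<nu> (Suc k)))"
    using mono by (intro ennreal_suminf_SUP_eq[symmetric]) (auto simp: incseq_def intro!: mult_left_mono)
  also have "\<dots> = (\<Sum>k. of_nat (Suc k) * (\<integral>\<^sup>+x. (SUP i. U i) x \<partial>rescaled_measure \<nu> (Suc k)))"
    using seq unfolding SUP_apply
    by (subst nn_integral_monotone_convergence_SUP)
      (auto simp: rescaled_measure_def SUP_mult_left_ennreal)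
  finally show ?case .
qed

text \<open>Integrability makes the \<open>ennreal\<close> series of the previous lemma finite,
  hence each of its terms finite, and the identity can be read in the reals.\<close>

lemma nonneg_integral_limit_measure_sums:
  fixes f :: "real \<Rightarrow> real"
  assumes f: "integrable (limit_measure \<nu>) f" "\<And>x. 0 \<le> f x"
  shows "(\<lambda>k. real (Suc k) * (LINT x|rescaled_measure \<nu> (Suc k). f x)) sums
    (LINT x|limit_measure \<nu>. f x)"
proof -
  have meas [measurable]: "f \<in> borel_measurable borel"
    using borel_measurable_integrable[OF f(1)] by simp
  have fin: "(\<integral>\<^sup>+x. ennreal (f x) \<partial>limit_measure \<nu>) < \<infinity>"
    using f by (simp add: integrable_iff_bounded)
  define a where "a k = of_nat (Suc k) * (\<integral>\<^sup>+x. ennreal (f x) \<partial>rescaled_measure \<nu> (Suc k))" for k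
  have suma: "suminf a = (\<integral>\<^sup>+x. ennreal (f x) \<partial>limit_measure \<nu>)"
    unfolding a_def by (rule nn_integral_limit_measure[symmetric]) simp
  have a_le: "a k \<le> suminf a" for k
    using sum_le_suminf[of a "{k}"] by simp
  \<comment> \<open>\<open>enn2real\<close> sends infinity to 0, so the round trip is faithful only
    because each term lies below the finite total.\<close>
  have a: "ennreal (enn2real (a k)) = a k" for k
    using a_le[of k] fin unfolding suma by (simp add: less_top)
  have "(\<Sum>k. ennreal (enn2real (a k))) = ennreal (LINT x|limit_measure \<nu>. f x)"
    using f by (simp only: a suma nn_integral_eq_integral AE_I2)
  then have "(\<lambda>k. ennreal (enn2real (a k))) sums ennreal (LINT x|limit_measure \<nu>. f x)"
    by (metis summableI summable_sums)
  then have "(\<lambda>k. enn2real (a k)) sums (LINT x|limit_measure \<nu>. f x)"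
    using f by (subst (asm) sums_ennreal) simp_all
  moreover have "enn2real (a k) = real (Suc k) * (LINT x|rescaled_measure \<nu> (Suc k). f x)" for k
    unfolding a_def enn2real_mult using f
    by (subst integral_eq_nn_integral) (auto simp: rescaled_measure_def ennreal_of_nat_eq_real_of_nat)
  ultimately show ?thesis
    by simp
qed

text \<open>The weight \<open>Suc k\<close> is at least 1, so the norm integral against one rescaled
  measure is bounded by its weighted term, and thus by the whole finite series.\<close>

lemma integrable_rescaled_measure:
  fixes f :: "real \<Rightarrow> 'a::{banach, second_countable_topology}"
  assumes "integrable (limit_measure \<nu>) f"
  shows "integrable (rescaled_measure \<nu> (Suc k)) f"
proof (rule integrableI_bounded)
  have meas [measurable]: "f \<in> borel_measurable borel"
    using borel_measurable_integrable[OF assms] by simp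
  then show "f \<in> borel_measurable (rescaled_measure \<nu> (Suc k))"
    by (simp add: rescaled_measure_def)
  let ?a = "\<lambda>k. of_nat (Suc k) * (\<integral>\<^sup>+x. ennreal (norm (f x)) \<partial>rescaled_measure \<nu> (Suc k))"
  have "1 * (\<integral>\<^sup>+x. ennreal (norm (f x)) \<partial>rescaled_measure \<nu> (Suc k)) \<le> ?a k"
    by (intro mult_right_mono) auto
  also have "\<dots> \<le> suminf ?a"
    using sum_le_suminf[of ?a "{k}"] by simp
  also have "\<dots> < \<infinity>"
    using assms by (subst nn_integral_limit_measure[symmetric]) (auto simp: integrable_iff_bounded)
  finally show "(\<integral>\<^sup>+x. ennreal (norm (f x)) \<partial>rescaled_measure \<nu> (Suc k)) < \<infinity>"
    by simp
qed

text \<open>Positive and negative parts reduce this to the nonnegative case; integrability of both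
  parts for every rescaled measure permits the recombination term by term.\<close>

lemma real_integral_limit_measure_sums:
  fixes f :: "real \<Rightarrow> real"
  assumes f: "integrable (limit_measure \<nu>) f"
  shows "(\<lambda>k. real (Suc k) * (LINT x|rescaled_measure \<nu> (Suc k). f x)) sums
    (LINT x|limit_measure \<nu>. f x)"
proof -
  let ?p = "\<lambda>x. max (f x) 0" and ?n = "\<lambda>x. max (- f x) 0"
  have int: "integrable (limit_measure \<nu>) ?p" "integrable (limit_measure \<nu>) ?n"
    using f by auto
  have split: "(LINT x|m. f x) = (LINT x|m. ?p x) - (LINT x|m. ?n x)"
    if "integrable m ?p" "integrable m ?n" for m
    unfolding Bochner_Integration.integral_diff[OF that, symmetric]
    by (intro Bochner_Integration.integral_cong) auto
  have "(\<lambda>k. real (Suc k) * (LINT x|rescaled_measure \<nu> (Suc k). ?p x) -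
        real (Suc k) * (LINT x|rescaled_measure \<nu> (Suc k). ?n x)) sums
      ((LINT x|limit_measure \<nu>. ?p x) - (LINT x|limit_measure \<nu>. ?n x))"
    by (intro sums_diff nonneg_integral_limit_measure_sums int) simp_all
  then show ?thesis
    using int by (simp add: split integrable_rescaled_measure right_diff_distrib del: of_nat_Suc)
qed

text \<open>Convergence of a complex series is componentwise, so the real case applies to the real
  and imaginary parts.\<close>

lemma integral_limit_measure_sums:
  fixes f :: "real \<Rightarrow> complex"
  assumes f: "integrable (limit_measure \<nu>) f"
  shows "(\<lambda>k. complex_of_real (real (Suc k)) * (CLINT x|rescaled_measure \<nu> (Suc k). f x)) sums
    (CLINT x|limit_measure \<nu>. f x)"
proof -
  have Re: "(LINT x|m. Re (f x)) = Re (CLINT x|m. f x)"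
   and Im: "(LINT x|m. Im (f x)) = Im (CLINT x|m. f x)" if "integrable m f" for m
    using that by simp_all
  show ?thesis
    using real_integral_limit_measure_sums[of \<nu> "\<lambda>x. Re (f x)"]
      real_integral_limit_measure_sums[of \<nu> "\<lambda>x. Im (f x)"] f
    by (simp add: sums_complex_iff integrable_rescaled_measure del: of_nat_Suc)
qed

section \<open>Taylor remainder of the imaginary exponential and the Levy exponent\<close>

definition iexp_remainder :: "real \<Rightarrow> complex" where
  "iexp_remainder x = iexp x - 1 - \<i> * complex_of_real x + complex_of_real (x\<^sup>2 / 2)"

lemma iexp_remainder_measurable [measurable]: "iexp_remainder \<in> borel_measurable borel"
  unfolding iexp_remainder_def by measurable

text \<open>The general Taylor error \<open>\<bar>x\<bar> ^ (n + 1) / fact (n + 1)\<close> at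
  \<open>n = 2\<close>, where the factorial is 6. The quadratic Taylor term is
  \<open>- x\<^sup>2 / 2\<close>, hence the plus sign in the remainder.\<close>

lemma norm_iexp_remainder_le: "norm (iexp_remainder x) \<le> \<bar>x\<bar> ^ 3 / 6"
  using iexp_approx1[of x 2]
  by (simp add: iexp_remainder_def eval_nat_numeral fact_numeral power_mult_distrib algebra_simps)

lemma integrable_abs_cube:
  assumes [measurable_cong]: "sets m = sets borel"
    and "(\<integral>\<^sup>+x. ennreal (\<bar>x\<bar> ^ 3) \<partial>m) < \<infinity>"
  shows "integrable m (\<lambda>x::real. \<bar>x\<bar> ^ 3)"
  by (rule integrableI_bounded) (use assms in \<open>simp_all add: power_abs\<close>)

text \<open>The measure may have infinite mass, in which case \<open>iexp (u * x)\<close> alone is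
  not integrable. The cubic bound controls the whole combination near 0 and at infinity
  alike.\<close>

lemma integrable_iexp_remainder:
  assumes [measurable_cong]: "sets m = sets borel" and "integrable m (\<lambda>x::real. \<bar>x\<bar> ^ 3)"
  shows "integrable m (\<lambda>x. iexp_remainder (u * x))"
proof (rule Bochner_Integration.integrable_bound)
  show "integrable m (\<lambda>x. \<bar>u\<bar> ^ 3 / 6 * \<bar>x\<bar> ^ 3)"
    using assms by simp
  show "AE x in m. norm (iexp_remainder (u * x)) \<le> norm (\<bar>u\<bar> ^ 3 / 6 * \<bar>x\<bar> ^ 3)"
    using norm_iexp_remainder_le[of "u * _"] by (auto simp: abs_mult power_mult_distrib)
qed measurable

text \<open>The explicit factor \<open>\<bar>u\<bar> ^ 3\<close> serves twice: it gives the majorant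
  of the M-test and the continuity of the limiting exponent at 0.\<close>

lemma norm_integral_iexp_remainder_le:
  assumes "sets m = sets borel" and "integrable m (\<lambda>x::real. \<bar>x\<bar> ^ 3)"
  shows "norm (CLINT x|m. iexp_remainder (u * x)) \<le> \<bar>u\<bar> ^ 3 / 6 * (LINT x|m. \<bar>x\<bar> ^ 3)"
proof -
  have "norm (CLINT x|m. iexp_remainder (u * x)) \<le> (LINT x|m. norm (iexp_remainder (u * x)))"
    by (rule integral_norm_bound)
  also have "\<dots> \<le> (LINT x|m. \<bar>u\<bar> ^ 3 / 6 * \<bar>x\<bar> ^ 3)"
    using integrable_iexp_remainder[OF assms, of u] assms norm_iexp_remainder_le[of "u * _"]
    by (intro integral_mono) (auto simp: abs_mult power_mult_distrib)
  finally show ?thesis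
    by simp
qed

lemma limit_exponent_eq: "limit_exponent m u = (CLINT x|m. iexp_remainder (u * x))"
  unfolding limit_exponent_def iexp_remainder_def by (simp add: power_mult_distrib)

text \<open>Completing the integrand by \<open>u\<^sup>2 * x\<^sup>2 / 2\<close> costs
  \<open>u\<^sup>2 * (1 - s) / 2\<close>, which together with the Gaussian term
  \<open>s * u\<^sup>2 / 2\<close> makes \<open>u\<^sup>2 / 2\<close>, whatever \<open>s\<close>
  is.\<close>

lemma levy_exponent_eq:
  assumes [measurable_cong]: "sets m = sets borel"
    and sq: "integrable m (\<lambda>x. x\<^sup>2)" "(LINT x|m. x\<^sup>2) = 1 - s"
    and cube: "integrable m (\<lambda>x. \<bar>x\<bar> ^ 3)"
  shows "levy_exponent s m u = (CLINT x|m. iexp_remainder (u * x)) - complex_of_real (u\<^sup>2 / 2)"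
proof -
  let ?q = "\<lambda>x. complex_of_real (u\<^sup>2 / 2) * complex_of_real (x\<^sup>2)"
  have q: "integrable m ?q"
    using sq by (intro integrable_mult_right integrable_of_real) auto
  have "(CLINT x|m. iexp (u * x) - 1 - \<i> * complex_of_real (u * x)) =
      (CLINT x|m. iexp_remainder (u * x) - ?q x)"
    by (simp add: iexp_remainder_def power_mult_distrib)
  also have "\<dots> = (CLINT x|m. iexp_remainder (u * x)) - (CLINT x|m. ?q x)"
    using q cube assms(1) by (intro Bochner_Integration.integral_diff integrable_iexp_remainder)
  also have "(CLINT x|m. ?q x) = complex_of_real (u\<^sup>2 / 2) * complex_of_real (1 - s)"
    by (simp only: integral_mult_right_zero integral_complex_of_real sq)
  finally show ?thesis
    unfolding levy_exponent_def by (simp add: algebra_simps diff_divide_distrib)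
qed

section \<open>Characteristic function of the weighted row sums\<close>

text \<open>Independence of the entire array turns the characteristic function into a product over
  all pairs. The weight \<open>1 / n\<close> rescales the argument, and the \<open>n\<close> equal
  factors of row \<open>n\<close> form a power.\<close>

lemma (in prob_space) char_harmonic_sum:
  fixes X :: "nat \<Rightarrow> nat \<Rightarrow> 'a \<Rightarrow> real" and \<mu> :: "nat \<Rightarrow> real measure"
  assumes indep: "indep_vars (\<lambda>_. borel) (\<lambda>(n, i). X n i) {(n, i). 1 \<le> i \<and> i \<le> n}"
    and law: "\<And>n i. 1 \<le> i \<Longrightarrow> i \<le> n \<Longrightarrow> distr M borel (X n i) = \<mu> n"
  shows "(CLINT \<omega>|M. iexp (u * (\<Sum>n=1..N. (1 / real n) * (\<Sum>i=1..n. X n i \<omega>)))) =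
    (\<Prod>n=1..N. char (\<mu> n) (u / real n) ^ n)"
proof -
  let ?A = "SIGMA n:{1..N}. {1..n}"
  \<comment> \<open>The double sum is flattened to one sum over pairs. \<open>?Y\<close> keeps the
    \<open>case\<close> expression of the hypothesis inside, so that independence passes to the
    scaled variables by composition.\<close>
  let ?Y = "\<lambda>p \<omega>. (1 / real (fst p)) * (case p of (n, i) \<Rightarrow> X n i) \<omega>"
  have rv: "X n i \<in> borel_measurable M" if "1 \<le> i" "i \<le> n" for n i
    using indep that unfolding indep_vars_def2 by auto
  have "indep_vars (\<lambda>_. borel) (\<lambda>(n, i). X n i) ?A"
    by (rule indep_vars_subset[OF indep]) auto
  then have ind: "indep_vars (\<lambda>_. borel) ?Y ?A"
    by (rule indep_vars_compose2) simp
  have Z: "(\<Sum>n=1..N. (1 / real n) * (\<Sum>i=1..n. X n i \<omega>)) = (\<Sum>p\<in>?A. ?Y p \<omega>)" for \<omega>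
    by (simp add: sum.Sigma sum_distrib_left split_beta)
  have meas [measurable]: "(\<lambda>\<omega>. \<Sum>p\<in>?A. ?Y p \<omega>) \<in> borel_measurable M"
    using ind by (intro borel_measurable_sum) (auto simp: indep_vars_def2)
  have Y: "char (distr M borel (?Y (n, i))) u = char (\<mu> n) (u / real n)"
    if "1 \<le> i" "i \<le> n" for n i
    using rv[OF that] unfolding law[OF that, symmetric] char_def
    by (simp add: integral_distr)
  have "(CLINT \<omega>|M. iexp (u * (\<Sum>n=1..N. (1 / real n) * (\<Sum>i=1..n. X n i \<omega>)))) =
      char (distr M borel (\<lambda>\<omega>. \<Sum>p\<in>?A. ?Y p \<omega>)) u"
    unfolding Z char_def by (subst integral_distr[OF meas]) simp_all
  also have "\<dots> = (\<Prod>p\<in>?A. char (distr M borel (?Y p)) u)"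
    by (rule char_distr_sum[OF ind])
  also have "\<dots> = (\<Prod>n=1..N. \<Prod>i=1..n. char (distr M borel (?Y (n, i))) u)"
    by (subst prod.Sigma) (simp_all add: split_beta)
  also have "\<dots> = (\<Prod>n=1..N. \<Prod>i=1..n. char (\<mu> n) (u / real n))"
    using Y by (intro prod.cong refl) auto
  finally show ?thesis
    by simp
qed

section \<open>Mod-Gaussian convergence of the harmonic sums\<close>

theorem theorem3p9:
  fixes M :: "'w measure"
    and X :: "nat \<Rightarrow> nat \<Rightarrow> 'w \<Rightarrow> real"
    and \<mu> \<nu> :: "nat \<Rightarrow> real measure"
    and \<sigma> :: "nat \<Rightarrow> real"
  assumes "prob_space M"
    and indep: "prob_space.indep_vars M (\<lambda>_. borel) (\<lambda>(n, i). X n i) {(n, i). 1 \<le> i \<and> i \<le> n}"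
    and law: "\<And>n i. 1 \<le> i \<Longrightarrow> i \<le> n \<Longrightarrow> distr M borel (X n i) = \<mu> n"
    and mean: "\<And>n. n \<ge> 1 \<Longrightarrow> integrable (\<mu> n) (\<lambda>x. x)"
      "\<And>n. n \<ge> 1 \<Longrightarrow> prob_space.expectation (\<mu> n) (\<lambda>x. x) = 0"
    and variance: "\<And>n. n \<ge> 1 \<Longrightarrow> integrable (\<mu> n) (\<lambda>x. x\<^sup>2)"
      "\<And>n. n \<ge> 1 \<Longrightarrow> prob_space.variance (\<mu> n) (\<lambda>x. x) = 1"
    and third_moments: "(\<Sum>k. ennreal (1 / (real (Suc k))\<^sup>2) * (\<integral>\<^sup>+x. ennreal (\<bar>x\<bar> ^ 3) \<partial>\<mu> (Suc k))) < \<infinity>"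
    and inf_div: "\<And>n. n \<ge> 1 \<Longrightarrow> infinitely_divisible (\<mu> n)"
    and sigma_nonneg: "\<And>n. n \<ge> 1 \<Longrightarrow> \<sigma> n \<ge> 0"
    and levy: "\<And>n. n \<ge> 1 \<Longrightarrow> levy_measure (\<nu> n)"
    and char_fun: "\<And>n u. n \<ge> 1 \<Longrightarrow> char (\<mu> n) u = exp (levy_exponent (\<sigma> n) (\<nu> n) u)"
    and levy_second_moment: "\<And>n. n \<ge> 1 \<Longrightarrow> integrable (\<nu> n) (\<lambda>x. x\<^sup>2)"
      "\<And>n. n \<ge> 1 \<Longrightarrow> (LINT x|\<nu> n. x\<^sup>2) = 1 - \<sigma> n"
      "\<And>n. n \<ge> 1 \<Longrightarrow> 1 - \<sigma> n \<in> {0..1}"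
    and levy_third_moment: "\<And>n. n \<ge> 1 \<Longrightarrow> (\<integral>\<^sup>+x. ennreal (\<bar>x\<bar> ^ 3) \<partial>\<nu> n) < \<infinity>"
    and levy_third_moments: "(\<Sum>k. ennreal (1 / (real (Suc k))\<^sup>2) * (\<integral>\<^sup>+x. ennreal (\<bar>x\<bar> ^ 3) \<partial>\<nu> (Suc k))) < \<infinity>"
  shows "strongly_mod_gaussian_convergent M
           (\<lambda>N \<omega>. \<Sum>n=1..N. (1 / real n) * (\<Sum>i=1..n. X n i \<omega>))
           (\<lambda>N. 0) (\<lambda>N. harm N)
           (\<lambda>u. exp (limit_exponent (limit_measure \<nu>) u))
         \<and> measure_space UNIV (sets borel) (limit_set_function \<nu>)
         \<and> emeasure (limit_measure \<nu>) {0} = 0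
         \<and> (\<integral>\<^sup>+x. ennreal (\<bar>x\<bar> ^ 3) \<partial>limit_measure \<nu>) < \<infinity>"
proof -
  interpret prob_space M
    by fact
  let ?L = "limit_measure \<nu>"
  let ?Z = "\<lambda>N \<omega>. \<Sum>n=1..N. (1 / real n) * (\<Sum>i=1..n. X n i \<omega>)"
  define \<Psi> where "\<Psi> = limit_exponent ?L"
  \<comment> \<open>The index is shifted: \<open>t k\<close> is the contribution of row
    \<open>n = Suc k\<close>. Its factor \<open>Suc k\<close> is at once the number of variables in
    that row and the weight of the rescaled measure in \<open>?L\<close>.\<close>
  define t where "t k u = complex_of_real (real (Suc k)) *
    (CLINT x|\<nu> (Suc k). iexp_remainder (u / real (Suc k) * x))" for k u
  have sets [measurable_cong, simp]: "sets (\<nu> (Suc k)) = sets borel" for k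
    using levy[of "Suc k"] by (simp add: levy_measure_def)
  have cube: "integrable (\<nu> (Suc k)) (\<lambda>x. \<bar>x\<bar> ^ 3)" for k
    using levy_third_moment[of "Suc k"] by (intro integrable_abs_cube) simp_all

  \<comment> \<open>Mass at 0 and third moment of the limit measure\<close>
  have zero: "emeasure ?L {0} = 0"
  proof -
    have "emeasure (rescaled_measure \<nu> (Suc k)) {0} = 0" for k
    proof -
      have "(\<lambda>x. x / real (Suc k)) -` {0} \<inter> space (\<nu> (Suc k)) = {0}"
        using sets_eq_imp_space_eq[OF sets] by (auto simp del: of_nat_Suc)
      then show ?thesis
        using levy[of "Suc k"] unfolding rescaled_measure_def
        by (subst emeasure_distr) (auto simp: levy_measure_def)
    qed
    then show ?thesis
      by (simp add: emeasure_limit_measure limit_set_function_def)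
  qed

  have third: "(\<integral>\<^sup>+x. ennreal (\<bar>x\<bar> ^ 3) \<partial>?L) < \<infinity>"
  proof -
    \<comment> \<open>With \<open>n = Suc k\<close>, the weight \<open>n\<close> against the factor
      \<open>1 / n ^ 3\<close> from the rescaled cube leaves \<open>1 / n ^ 2\<close>, the weight in
      \<open>levy_third_moments\<close>.\<close>
    have "of_nat (Suc k) * (\<integral>\<^sup>+x. ennreal (\<bar>x\<bar> ^ 3) \<partial>rescaled_measure \<nu> (Suc k)) =
        ennreal (1 / (real (Suc k))\<^sup>2) * (\<integral>\<^sup>+x. ennreal (\<bar>x\<bar> ^ 3) \<partial>\<nu> (Suc k))" for k
    proof -
      have "of_nat (Suc k) * (\<integral>\<^sup>+x. ennreal (\<bar>x\<bar> ^ 3) \<partial>rescaled_measure \<nu> (Suc k)) =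
          (\<integral>\<^sup>+x. ennreal (real (Suc k)) * ennreal (\<bar>x / real (Suc k)\<bar> ^ 3) \<partial>\<nu> (Suc k))"
        unfolding rescaled_measure_def ennreal_of_nat_eq_real_of_nat
        by (simp add: nn_integral_distr nn_integral_cmult del: of_nat_Suc)
      also have "\<dots> = (\<integral>\<^sup>+x. ennreal (1 / (real (Suc k))\<^sup>2) * ennreal (\<bar>x\<bar> ^ 3) \<partial>\<nu> (Suc k))"
        by (intro nn_integral_cong, subst (1 2) ennreal_mult[symmetric])
          (simp_all add: power_divide abs_divide eval_nat_numeral del: of_nat_Suc)
      finally show ?thesis
        by (simp add: nn_integral_cmult del: of_nat_Suc)
    qed
    then show ?thesis
      using levy_third_moments by (subst nn_integral_limit_measure) (simp_all del: of_nat_Suc)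
  qed
  have cubeL: "integrable ?L (\<lambda>x. \<bar>x\<bar> ^ 3)"
    using third by (intro integrable_abs_cube) simp_all

  \<comment> \<open>Series expansion of the limiting exponent and its majorant\<close>
  have resc: "(LINT x|rescaled_measure \<nu> (Suc k). f x) = (LINT x|\<nu> (Suc k). f (x / real (Suc k)))"
    if "f \<in> borel_measurable borel" for k and f :: "real \<Rightarrow> 'b::{banach, second_countable_topology}"
    unfolding rescaled_measure_def using that by (intro integral_distr) simp_all

  \<comment> \<open>Termwise integration of the remainder against \<open>?L\<close>; the change of
    variables moves the scaling by \<open>Suc k\<close> from \<open>x\<close> to
    \<open>u\<close>.\<close>
  have t_sums: "(\<lambda>k. t k u) sums \<Psi> u" for u
    using integral_limit_measure_sums[OF integrable_iexp_remainder[OF _ cubeL], of u]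
    unfolding \<Psi>_def limit_exponent_eq t_def by (simp add: resc del: of_nat_Suc)

  define c where "c k = (LINT x|\<nu> (Suc k). \<bar>x\<bar> ^ 3) / (real (Suc k))\<^sup>2" for k
  \<comment> \<open>\<open>c\<close> is the termwise integral of \<open>\<bar>x\<bar> ^ 3\<close>
    against \<open>?L\<close>, so its summability is the finite third moment of
    \<open>?L\<close>.\<close>
  have c: "summable c"
  proof -
    have "real (Suc k) * (LINT x|rescaled_measure \<nu> (Suc k). \<bar>x\<bar> ^ 3) = c k" for k
      by (simp add: resc c_def power_divide abs_divide eval_nat_numeral del: of_nat_Suc)
    then show ?thesis
      using real_integral_limit_measure_sums[OF cubeL] by (simp add: sums_iff)
  qed
  have t_le: "norm (t k u) \<le> \<bar>u\<bar> ^ 3 / 6 * c k" for k u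
  proof -
    have "norm (t k u) \<le> real (Suc k) * (\<bar>u / real (Suc k)\<bar> ^ 3 / 6 * (LINT x|\<nu> (Suc k). \<bar>x\<bar> ^ 3))"
      unfolding t_def norm_mult norm_of_real abs_of_nat
      by (intro mult_left_mono norm_integral_iexp_remainder_le cube) simp_all
    also have "\<dots> = \<bar>u\<bar> ^ 3 / 6 * c k"
      by (simp add: c_def power_divide abs_divide field_simps eval_nat_numeral del: of_nat_Suc)
    finally show ?thesis .
  qed

  \<comment> \<open>The normalised characteristic function as the exponential of a partial
    sum\<close>
  have char_eq: "exp (- \<i> * complex_of_real (u * 0) + complex_of_real (u\<^sup>2 * harm N / 2)) *
      (CLINT \<omega>|M. iexp (u * ?Z N \<omega>)) = exp (\<Sum>k<N. t k u)" for N u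
  proof -
    \<comment> \<open>\<open>n - 1\<close> undoes the index shift in \<open>t\<close>. The
      subtracted term is \<open>n\<close> times \<open>(u / n)\<^sup>2 / 2\<close>.\<close>
    have summand: "of_nat n * levy_exponent (\<sigma> n) (\<nu> n) (u / real n) =
        t (n - 1) u - complex_of_real (u\<^sup>2 / 2 * (1 / real n))" if "n \<in> {1..N}" for n
    proof -
      obtain k where n: "n = Suc k"
        using \<open>n \<in> {1..N}\<close> by (cases n) auto
      have "levy_exponent (\<sigma> n) (\<nu> n) (u / real n) =
          (CLINT x|\<nu> n. iexp_remainder (u / real n * x)) - complex_of_real ((u / real n)\<^sup>2 / 2)"
        using levy_second_moment[of n] cube[of k] unfolding n
        by (intro levy_exponent_eq) simp_all
      then show ?thesis
        unfolding n t_def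
        by (simp add: power2_eq_square right_diff_distrib del: of_nat_Suc)
    qed
    have "(CLINT \<omega>|M. iexp (u * ?Z N \<omega>)) = (\<Prod>n=1..N. char (\<mu> n) (u / real n) ^ n)"
      by (rule char_harmonic_sum[OF indep law])
    also have "\<dots> = (\<Prod>n=1..N. exp (of_nat n * levy_exponent (\<sigma> n) (\<nu> n) (u / real n)))"
      by (intro prod.cong refl) (simp add: char_fun exp_of_nat_mult)
    also have "\<dots> = exp (\<Sum>n=1..N. of_nat n * levy_exponent (\<sigma> n) (\<nu> n) (u / real n))"
      by (simp add: exp_sum)
    also have "(\<Sum>n=1..N. of_nat n * levy_exponent (\<sigma> n) (\<nu> n) (u / real n)) =
        (\<Sum>n=1..N. t (n - 1) u - complex_of_real (u\<^sup>2 / 2 * (1 / real n)))"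
      by (intro sum.cong refl summand)
    \<comment> \<open>The leftover quadratic terms add up to \<open>u\<^sup>2 * harm N / 2\<close>,
      exactly the exponent of the normalising factor, which then cancels.\<close>
    also have "\<dots> = (\<Sum>k<N. t k u) - complex_of_real (u\<^sup>2 * harm N / 2)"
    proof -
      have "(\<Sum>n=1..N. t (n - 1) u) = (\<Sum>k<N. t k u)"
        using sum.atLeast1_atMost_eq[of "\<lambda>n. t (n - 1) u" N] by simp
      moreover have "(\<Sum>n=1..N. u\<^sup>2 / 2 * (1 / real n)) = u\<^sup>2 * harm N / 2"
        unfolding sum_distrib_left[symmetric] harm_def by (simp add: inverse_eq_divide)
      ultimately show ?thesis
        by (simp only: sum_subtractf of_real_sum[symmetric])
    qed
    finally show ?thesis
      by (simp add: exp_diff)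
  qed

  \<comment> \<open>Uniform convergence on compact sets\<close>
  have unif: "uniform_limit K (\<lambda>N u. exp (\<Sum>k<N. t k u)) (\<lambda>u. exp (\<Psi> u)) sequentially"
    if K: "compact K" for K
  proof -
    obtain B where B: "\<And>u. u \<in> K \<Longrightarrow> \<bar>u\<bar> \<le> B"
      using compact_imp_bounded[OF K] by (auto simp: bounded_iff)
    \<comment> \<open>\<open>C\<close> will bound every partial sum on \<open>K\<close>. This
      matters because \<open>exp\<close> is not uniformly continuous on the whole plane, but it is
      on a closed ball.\<close>
    define C where "C = B ^ 3 / 6 * suminf c"
    have c0: "c k \<ge> 0" for k
      by (simp add: c_def)
    have le: "norm (t k u) \<le> B ^ 3 / 6 * c k" if "u \<in> K" for k u
      using B[OF that] c0[of k]
      by (intro order_trans[OF t_le]) (auto intro!: mult_right_mono divide_right_mono power_mono)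
    have lim: "uniform_limit K (\<lambda>N u. \<Sum>k<N. t k u) \<Psi> sequentially"
      using Weierstrass_m_test[of K t "\<lambda>k. B ^ 3 / 6 * c k"] le c t_sums
      by (simp add: sums_iff)
    have bnd: "norm (\<Sum>k<N. t k u) \<le> C" if "u \<in> K" for N u
    proof -
      have "norm (\<Sum>k<N. t k u) \<le> (\<Sum>k<N. B ^ 3 / 6 * c k)"
        by (intro sum_norm_le le that)
      \<comment> \<open>The omitted terms are nonnegative: the point \<open>u\<close> of
        \<open>K\<close> supplies \<open>0 \<le> \<bar>u\<bar> \<le> B\<close>.\<close>
      also have "\<dots> \<le> (\<Sum>k. B ^ 3 / 6 * c k)"
        using c c0 order_trans[OF abs_ge_zero B[OF that]]
        by (intro sum_le_suminf) (auto intro!: summable_mult)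
      finally show ?thesis
        unfolding C_def suminf_mult[OF c] .
    qed
    \<comment> \<open>All partial sums lie in this closed ball, so uniform convergence of the
      exponents passes to their exponentials.\<close>
    have "uniformly_continuous_on (cball 0 C) (exp :: complex \<Rightarrow> complex)"
      by (intro compact_uniformly_continuous continuous_intros) simp
    then show ?thesis
      using bnd by (intro uniform_limit_compose_uniformly_continuous_on[OF lim])
        (auto intro!: always_eventually)
  qed

  \<comment> \<open>Continuity of the limiting function at 0\<close>
  have cont: "isCont (\<lambda>u. exp (\<Psi> u)) 0"
  proof -
    \<comment> \<open>One bound gives both halves of continuity: the limit 0 as \<open>u\<close>
      tends to 0, and, taken at \<open>u = 0\<close>, the value \<open>\<Psi> 0 = 0\<close>.\<close>
    have bnd: "norm (\<Psi> u) \<le> \<bar>u\<bar> ^ 3 / 6 * (LINT x|?L. \<bar>x\<bar> ^ 3)" for u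
      unfolding \<Psi>_def limit_exponent_eq by (intro norm_integral_iexp_remainder_le cubeL) simp
    have "((\<lambda>u. \<bar>u\<bar> ^ 3 / 6 * (LINT x|?L. \<bar>x\<bar> ^ 3)) \<longlongrightarrow> \<bar>0\<bar> ^ 3 / 6 * (LINT x|?L. \<bar>x\<bar> ^ 3)) (at (0::real))"
      by (intro tendsto_intros) auto
    then have "(\<Psi> \<longlongrightarrow> 0) (at 0)"
      using always_eventually[OF allI[OF bnd]] by (intro Lim_null_comparison[of \<Psi>]) simp_all
    moreover have "\<Psi> 0 = 0"
      using bnd[of 0] by simp
    ultimately have "isCont \<Psi> 0"
      by (simp add: isCont_def)
    then show ?thesis
      by (intro continuous_intros)
  qed

  have meas: "?Z N \<in> borel_measurable M" for N
    using indep unfolding indep_vars_def2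
    by (intro borel_measurable_sum borel_measurable_times borel_measurable_const) auto

  have "strongly_mod_gaussian_convergent M ?Z (\<lambda>N. 0) (\<lambda>N. harm N) (\<lambda>u. exp (\<Psi> u))"
    unfolding strongly_mod_gaussian_convergent_def char_eq
    using meas unif cont by (auto intro: harm_nonneg)
  then show ?thesis
    using zero third measure_space_limit_set_function unfolding \<Psi>_def by blast
qed

end
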